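(* Let $X$ be a Banach space and let $(M_n)_{n\in\mathbb N'}$ and $(P_n)_{n\in\mathbb N'}$ be two sequences of closed subspaces of $X$, with $M_n\neq\{\theta\}$ for all $n\in\mathbb N'$. Then $$\lambda_{\mathbb N'}[M_n,P_n]\ \le\ \varlimsup_{n\in\mathbb N'}\delta(M_n,P_n).$$
   Context: $\mathbb N'$ denotes an infinite subset of $\mathbb N$; $\theta$ is the null vector. For a vector $x\in X$ and a closed subspace $P$, $dist(x,P)=\inf\{\|x-y\| : y\in P\}$. For closed subspaces $M\ne\{\theta\}$ and $P$, the gap is $\delta(M,P)=\sup\{dist(x,P) : x\in M,\ \|x\|=1\}$. Uniform $\lambda$-adjustment: for $\lambda\ge 0$, the sequence $(M_n)_{\mathbb N'}$ (with all $M_n\ne\{\theta\}$) is lower uniformly $\lambda$-adjusted with $(P_n)_{\mathbb N'}$ if for every $\eta>0$, every infinite $\mathbb N''\subset\mathbb N'$ and every sequence of unit vectors $x_n\in M_n$ ($n\in\mathbb N''$), there exist an infinite $\mathbb N'''\subset\mathbb N''$, vectors $y_n\in P_n$ ($n\in\mathbb N'''$) and a vector $z\in X$ such that $\varlimsup_{n\in\mathbb N'''}\|x_n-y_n-z\|\le\lambda+\eta$. The number $\lambda_{\mathbb N'}[M_n,P_n]$ is the infimum of all $\lambda\ge0$ such that $(M_n)_{\mathbb N'}$ is lower uniformly $\lambda$-adjusted with $(P_n)_{\mathbb N'}$. *)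

theory Defs
  imports "HOL-Analysis.Analysis"
begin

text \<open>
  Sequences indexed by an infinite set \<open>N\<close> of naturals are functions on all of \<open>nat\<close>, of which
  only the values at indices in \<open>N\<close> matter. The upper limit along \<open>N\<close> is the \<open>Limsup\<close> with
  respect to the trace of \<open>sequentially\<close> on \<open>N\<close>; it is taken in the extended reals.
\<close>

abbreviation limsup_on :: "nat set \<Rightarrow> (nat \<Rightarrow> real) \<Rightarrow> ereal" where
  "limsup_on N f \<equiv> Limsup (inf sequentially (principal N)) (\<lambda>n. ereal (f n))"

definition gap :: "'a::real_normed_vector set \<Rightarrow> 'a set \<Rightarrow> real" where
  "gap M P = (SUP x\<in>{x \<in> M. norm x = 1}. infdist x P)"

definition lower_uniformly_adjusted ::
  "real \<Rightarrow> nat set \<Rightarrow> (nat \<Rightarrow> 'a::real_normed_vector set) \<Rightarrow> (nat \<Rightarrow> 'a set) \<Rightarrow> bool" where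
  "lower_uniformly_adjusted l N M P \<longleftrightarrow>
     (\<forall>\<eta>>0. \<forall>N2 x. N2 \<subseteq> N \<and> infinite N2 \<and> (\<forall>n\<in>N2. x n \<in> M n \<and> norm (x n) = 1) \<longrightarrow>
        (\<exists>N3 y z. N3 \<subseteq> N2 \<and> infinite N3 \<and> (\<forall>n\<in>N3. y n \<in> P n) \<and>
           limsup_on N3 (\<lambda>n. norm (x n - y n - z)) \<le> ereal (l + \<eta>)))"

definition adjustment_number ::
  "nat set \<Rightarrow> (nat \<Rightarrow> 'a::real_normed_vector set) \<Rightarrow> (nat \<Rightarrow> 'a set) \<Rightarrow> real" where
  "adjustment_number N M P = Inf {l. 0 \<le> l \<and> lower_uniformly_adjusted l N M P}"

text \<open>
  For subspaces, the supremum and the infimum above are taken over nonempty bounded sets of reals,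
  so that they are the true ones.
\<close>

lemma gap_Sup_wellformed:
  assumes "subspace M" "M \<noteq> {0}" "subspace P"
  shows "{x \<in> M. norm x = 1} \<noteq> {}"
    and "bdd_above ((\<lambda>x. infdist x P) ` {x \<in> M. norm x = 1})"
proof -
  from assms obtain v where v: "v \<in> M" "v \<noteq> 0"
    using subspace_0 by blast
  then have "v /\<^sub>R norm v \<in> {x \<in> M. norm x = 1}"
    using assms(1) by (simp add: subspace_scale)
  then show "{x \<in> M. norm x = 1} \<noteq> {}"
    by blast
  have "infdist x P \<le> 1" if "norm x = 1" for x
    using infdist_le[OF subspace_0[OF assms(3)], of x] that by simp
  then show "bdd_above ((\<lambda>x. infdist x P) ` {x \<in> M. norm x = 1})"
    by (intro bdd_aboveI[of _ 1]) auto
qed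

lemma adjustment_number_Inf_wellformed:
  assumes "\<And>n. n \<in> N \<Longrightarrow> subspace (P n)"
  shows "1 \<in> {l. 0 \<le> l \<and> lower_uniformly_adjusted l N M P}"
    and "bdd_below {l. 0 \<le> l \<and> lower_uniformly_adjusted l N M P}"
proof -
  have "lower_uniformly_adjusted 1 N M P"
    unfolding lower_uniformly_adjusted_def
  proof (intro allI impI, elim conjE)
    fix \<eta> :: real and N2 x
    assume A: "0 < \<eta>" "N2 \<subseteq> N" "infinite N2" "\<forall>n\<in>N2. x n \<in> M n \<and> norm (x n) = 1"
    have "limsup_on N2 (\<lambda>n. norm (x n - 0 - 0)) \<le> ereal (1 + \<eta>)"
      using A by (intro Limsup_bounded) (auto simp: eventually_inf_principal intro!: always_eventually)
    then show "\<exists>N3 y z. N3 \<subseteq> N2 \<and> infinite N3 \<and> (\<forall>n\<in>N3. y n \<in> P n) \<and>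
        limsup_on N3 (\<lambda>n. norm (x n - y n - z)) \<le> ereal (1 + \<eta>)"
      using A assms by (intro exI[of _ N2] exI[of _ "\<lambda>_. 0"] exI[of _ 0]) (auto intro: subspace_0)
  qed
  then show "1 \<in> {l. 0 \<le> l \<and> lower_uniformly_adjusted l N M P}"
    by simp
  show "bdd_below {l. 0 \<le> l \<and> lower_uniformly_adjusted l N M P}"
    by (intro bdd_belowI[of _ 0]) auto
qed

end

theory Submission
  imports Defs
begin

text \<open>A unit vector \<open>x n\<close> of \<open>M n\<close> lies within distance
  \<open>gap (M n) (P n)\<close> of \<open>P n\<close>, so some \<open>y n\<close> in
  \<open>P n\<close> approximates it up to the gap plus an arbitrarily small error. If a real
  \<open>l\<close> bounds the upper limit of the gaps, these errors are eventually below
  \<open>l + \<eta>\<close>, and the shift \<open>z = 0\<close> works without thinning the index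
  set. Hence every such \<open>l\<close> is an admissible adjustment constant
  (\<open>lower_uniformly_adjusted_limsup_gap\<close>), and the infimum of the admissible constants
  is at most \<open>l\<close>.\<close>

lemma infdist_less_obtain:
  assumes "A \<noteq> {}" "infdist x A < r"
  obtains a where "a \<in> A" "dist x a < r"
proof -
  have "(INF a\<in>A. dist x a) < r"
    using assms by (simp add: infdist_notempty)
  then show thesis
    using cInf_lessD[of "dist x ` A" r] assms(1) that by blast
qed

lemma infdist_le_gap:
  assumes "subspace P" "x \<in> M" "norm x = 1"
  shows "infdist x P \<le> gap M P"
proof -
  \<comment> \<open>A real \<open>SUP\<close> dominates its members only if they are bounded above;
    comparing with 0 in \<open>P\<close> gives the bound 1.\<close>
  have "infdist u P \<le> 1" if "norm u = 1" for u
    using infdist_le[OF subspace_0[OF assms(1)], of u] that by simp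
  then have "bdd_above ((\<lambda>u. infdist u P) ` {u \<in> M. norm u = 1})"
    by (intro bdd_aboveI[of _ 1]) auto
  then show ?thesis
    unfolding gap_def using assms by (intro cSUP_upper) auto
qed

lemma gap_nonneg:
  assumes "subspace M" "M \<noteq> {0}" "subspace P"
  shows "0 \<le> gap M P"
proof -
  obtain x where "x \<in> M" "norm x = 1"
    using gap_Sup_wellformed(1)[OF assms] by blast
  then show ?thesis
    using infdist_le_gap[OF assms(3)] infdist_nonneg order_trans by blast
qed

text \<open>Along the trivial filter every \<open>Limsup\<close> is minus infinity, so this is what
  lets a lower bound on the gaps pass to their upper limit.\<close>

lemma inf_sequentially_principal_neq_bot:
  assumes "infinite N"
  shows "inf sequentially (principal N) \<noteq> bot"
  using assms
  by (auto simp: trivial_limit_def eventually_inf_principal eventually_sequentially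
      infinite_nat_iff_unbounded_le)

lemma lower_uniformly_adjusted_limsup_gap:
  assumes P: "\<And>n. n \<in> N \<Longrightarrow> subspace (P n)"
    and l: "limsup_on N (\<lambda>n. gap (M n) (P n)) \<le> ereal l"
  shows "lower_uniformly_adjusted l N M P"
  unfolding lower_uniformly_adjusted_def
proof (intro allI impI, elim conjE)
  fix \<eta> :: real and N2 x
  assume \<eta>: "0 < \<eta>" and N2: "N2 \<subseteq> N" "infinite N2"
    and x: "\<forall>n\<in>N2. x n \<in> M n \<and> norm (x n) = 1"
  \<comment> \<open>The distance to \<open>P n\<close> need not be attained; half of
    \<open>\<eta>\<close> pays for a near-minimizer.\<close>
  have "\<exists>y. y \<in> P n \<and> norm (x n - y) < gap (M n) (P n) + \<eta>/2" if "n \<in> N2" for n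
  proof -
    have "subspace (P n)"
      using P N2 that by blast
    then have "P n \<noteq> {}" "infdist (x n) (P n) < gap (M n) (P n) + \<eta>/2"
      using infdist_le_gap[of "P n" "x n" "M n"] x \<eta> that subspace_0 by fastforce+
    then show ?thesis
      by (metis infdist_less_obtain dist_norm)
  qed
  then obtain y where y: "\<And>n. n \<in> N2 \<Longrightarrow> y n \<in> P n"
      "\<And>n. n \<in> N2 \<Longrightarrow> norm (x n - y n) < gap (M n) (P n) + \<eta>/2"
    by metis
  \<comment> \<open>The other half of \<open>\<eta>\<close> makes the bound on the upper limit
    strict, so that it holds for the gaps themselves at all large indices of \<open>N\<close>, hence
    of \<open>N2\<close>.\<close>
  have "limsup_on N (\<lambda>n. gap (M n) (P n)) < ereal (l + \<eta>/2)"
    using l by (rule order_le_less_trans) (use \<eta> in simp)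
  then have "\<forall>\<^sub>F n in sequentially. n \<in> N \<longrightarrow> gap (M n) (P n) < l + \<eta>/2"
    by (auto dest!: Limsup_lessD simp: eventually_inf_principal)
  then have "\<forall>\<^sub>F n in sequentially. n \<in> N2 \<longrightarrow> norm (x n - y n) \<le> l + \<eta>"
    by eventually_elim (use y(2) N2(1) in fastforce)
  then have "limsup_on N2 (\<lambda>n. norm (x n - y n - 0)) \<le> ereal (l + \<eta>)"
    by (intro Limsup_bounded) (simp add: eventually_inf_principal)
  then show "\<exists>N3 y z. N3 \<subseteq> N2 \<and> infinite N3 \<and> (\<forall>n\<in>N3. y n \<in> P n) \<and>
      limsup_on N3 (\<lambda>n. norm (x n - y n - z)) \<le> ereal (l + \<eta>)"
    using N2(2) y(1) by blast
qed

theorem lemma2p1p3: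
  fixes M P :: "nat \<Rightarrow> 'a::banach set" and N :: "nat set"
  assumes "infinite N"
    and "\<And>n. n \<in> N \<Longrightarrow> subspace (M n) \<and> closed (M n)"
    and "\<And>n. n \<in> N \<Longrightarrow> subspace (P n) \<and> closed (P n)"
    and "\<And>n. n \<in> N \<Longrightarrow> M n \<noteq> {0}"
  shows "ereal (adjustment_number N M P) \<le> limsup_on N (\<lambda>n. gap (M n) (P n))"
proof (rule ereal_le_real)
  \<comment> \<open>Testing against real upper bounds \<open>l\<close> also covers an infinite upper
    limit, where the claim is vacuous.\<close>
  fix l assume l: "limsup_on N (\<lambda>n. gap (M n) (P n)) \<le> ereal l"
  \<comment> \<open>Membership in the set whose infimum is taken requires \<open>0 \<le> l\<close>,
    which follows from the nonnegativity of the gaps.\<close>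
  have "0 \<le> limsup_on N (\<lambda>n. gap (M n) (P n))"
    using assms
    by (intro le_Limsup inf_sequentially_principal_neq_bot)
      (auto simp: eventually_inf_principal intro!: always_eventually gap_nonneg)
  then have "0 \<le> l"
    using l by (metis ereal_less_eq(5) order_trans)
  moreover have "lower_uniformly_adjusted l N M P"
    using assms(3) l by (intro lower_uniformly_adjusted_limsup_gap) auto
  moreover have "bdd_below {l. 0 \<le> l \<and> lower_uniformly_adjusted l N M P}"
    using assms(3) by (intro adjustment_number_Inf_wellformed) auto
  ultimately show "ereal (adjustment_number N M P) \<le> ereal l"
    unfolding adjustment_number_def by (auto intro: cInf_lower)
qed

end
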